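(* Let $S$ be a quandle and $T$ a medial quandle. Then $$\mathrm{Triv}(S,T)\cong\{f:c(S)\to U \;:\; U\text{ is a trivial subquandle of }T\text{ and }f\text{ is surjective}\}$$ as sets. If $U$ is a trivial subquandle of $T$ of size $n\le|c(S)|$, then there exist $$\frac{1}{n!}\sum_{j=1}^{n}(-1)^{n-j}\binom{n}{j}\,j^{|c(S)|}$$ homomorphisms $S\to T$ with image equal to $U$.
   Context: A quandle is a set $Q$ with a binary operation $\triangleright$ such that $x\triangleright x=x$ for all $x$; for all $y,z$ there is a unique $x$ with $y\triangleright x=z$; and $x\triangleright(y\triangleright z)=(x\triangleright y)\triangleright(x\triangleright z)$ for all $x,y,z$. It is medial if $(x\triangleright y)\triangleright(z\triangleright w)=(x\triangleright z)\triangleright(y\triangleright w)$ for all elements, and trivial if $x\triangleright y=y$ for all $x,y$. The components of $Q$ are the orbits of $Q$ under the group generated by the bijections $L_a:x\mapsto a\triangleright x$, $a\in Q$; $c(Q)$ denotes the set of components. $\mathrm{Triv}(S,T)$ is the set of quandle homomorphisms $h:S\to T$ whose image is a trivial quandle. In the displayed set, $U$ ranges over the trivial subquandles of $T$ and $f$ over the surjective maps from $c(S)$ onto $U$.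
   Formalization: Read as an exact count the printed formula is false (S=T=U trivial of size 2: 2 homomorphisms, formula gives 1); proved: at least that many homomorphisms exist, and for nonempty S with c(S) finite their exact number is the sum without the factor 1/n!. *)

theory Defs
  imports
    Complex_Main
    "HOL-Library.Equipollence"
    "HOL-Algebra.Bij"
    "HOL-Algebra.Generated_Groups"
    "HOL-Algebra.Group_Action"
begin

text \<open>The carrier of a quandle may be empty.\<close>

locale quandle =
  fixes Q :: "'a set" and op :: "'a \<Rightarrow> 'a \<Rightarrow> 'a"  (infixl "\<triangleright>" 70)
  assumes closed: "\<lbrakk>x \<in> Q; y \<in> Q\<rbrakk> \<Longrightarrow> x \<triangleright> y \<in> Q"
    and idem: "x \<in> Q \<Longrightarrow> x \<triangleright> x = x"
    and left_div: "\<lbrakk>y \<in> Q; z \<in> Q\<rbrakk> \<Longrightarrow> \<exists>!x. x \<in> Q \<and> y \<triangleright> x = z"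
    and left_distrib: "\<lbrakk>x \<in> Q; y \<in> Q; z \<in> Q\<rbrakk> \<Longrightarrow> x \<triangleright> (y \<triangleright> z) = (x \<triangleright> y) \<triangleright> (x \<triangleright> z)"

locale medial_quandle = quandle +
  assumes medial: "\<lbrakk>x \<in> Q; y \<in> Q; z \<in> Q; w \<in> Q\<rbrakk>
    \<Longrightarrow> (x \<triangleright> y) \<triangleright> (z \<triangleright> w) = (x \<triangleright> z) \<triangleright> (y \<triangleright> w)"

locale trivial_quandle = quandle +
  assumes trivial: "\<lbrakk>x \<in> Q; y \<in> Q\<rbrakk> \<Longrightarrow> x \<triangleright> y = y"

definition trivial_subquandle :: "'a set \<Rightarrow> 'a set \<Rightarrow> ('a \<Rightarrow> 'a \<Rightarrow> 'a) \<Rightarrow> bool" where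
  "trivial_subquandle U Q op \<longleftrightarrow> U \<subseteq> Q \<and> trivial_quandle U op"

text \<open>
  The group generated by the left translations, inside the group of all bijections of the
  carrier. Elements of \<^term>\<open>BijGroup Q\<close> are extensional, hence the restriction.
\<close>

definition left_mult_group :: "'a set \<Rightarrow> ('a \<Rightarrow> 'a \<Rightarrow> 'a) \<Rightarrow> ('a \<Rightarrow> 'a) monoid" where
  "left_mult_group Q op = subgroup_generated (BijGroup Q) {\<lambda>x\<in>Q. op a x | a. a \<in> Q}"

definition components :: "'a set \<Rightarrow> ('a \<Rightarrow> 'a \<Rightarrow> 'a) \<Rightarrow> 'a set set" where
  "components Q op = orbits (left_mult_group Q op) Q (\<lambda>g. g)"

text \<open>
  Homomorphisms are taken extensional, so that two of them are equal iff they agree on \<open>S\<close>.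
\<close>

definition quandle_hom ::
  "'a set \<Rightarrow> ('a \<Rightarrow> 'a \<Rightarrow> 'a) \<Rightarrow> 'b set \<Rightarrow> ('b \<Rightarrow> 'b \<Rightarrow> 'b) \<Rightarrow> ('a \<Rightarrow> 'b) set" where
  "quandle_hom S opS T opT =
     {h \<in> S \<rightarrow>\<^sub>E T. \<forall>x\<in>S. \<forall>y\<in>S. h (opS x y) = opT (h x) (h y)}"

definition Triv ::
  "'a set \<Rightarrow> ('a \<Rightarrow> 'a \<Rightarrow> 'a) \<Rightarrow> 'b set \<Rightarrow> ('b \<Rightarrow> 'b \<Rightarrow> 'b) \<Rightarrow> ('a \<Rightarrow> 'b) set" where
  "Triv S opS T opT = {h \<in> quandle_hom S opS T opT. trivial_quandle (h ` S) opT}"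

end

theory Submission
  imports Defs "HOL-Combinatorics.Stirling"
begin

text \<open>
  A homomorphism \<open>h\<close> with trivial image satisfies \<open>h (a \<triangleright> x) = h a \<triangleright> h x = h x\<close>, so it is
  constant on components; conversely any map that factors through the components and has trivial
  image is a homomorphism, because \<open>a \<triangleright> x\<close> and \<open>x\<close> lie in the same component. Homomorphisms onto a
  trivial subquandle \<open>U\<close> thus correspond to surjections from the set of components onto \<open>U\<close>. With
  \<open>k\<close> components and \<open>card U = n\<close> there are \<open>n! * Stirling k n\<close> of these, which is the alternating
  sum; the sum divided by \<open>n!\<close> is the Stirling number itself, which does not exceed that count.
\<close>

section \<open>Alternating binomial sums and Stirling numbers of the second kind\<close>

text \<open>Both sides satisfy \<open>a (Suc m) (Suc p) = Suc p * (a m (Suc p) + a m p)\<close>,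
  which for the right side is the Stirling recurrence multiplied by \<open>fact (Suc p)\<close>.
  Starting the sum at 0 makes the base case \<open>m = 0\<close> hold for \<open>n = 0\<close> as
  well.\<close>

lemma alternating_sum_eq_fact_Stirling:
  "(\<Sum>j\<le>n. (-1) ^ (n - j) * real (n choose j) * real j ^ m) = fact n * real (Stirling m n)"
proof (induction m arbitrary: n)
  case 0
  have "(\<Sum>j\<le>n. (-1) ^ (n - j) * real (n choose j)) = (1 + (-1)) ^ n"
    by (subst binomial_ring) (simp add: mult.commute)
  then show ?case
    by (cases n) simp_all
next
  case (Suc m)
  show ?case
  proof (cases n)
    case 0
    then show ?thesis by simp
  next
    case (Suc p)
    let ?F = "\<lambda>n. \<Sum>j\<le>n. (-1) ^ (n - j) * real (n choose j) * real j ^ m"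
    \<comment> \<open>Absorption followed by Pascal's rule; the difference form needs no index shift
      and also covers \<open>j = 0\<close>.\<close>
    have absorb: "real (n choose j) * real j = real n * (real (n choose j) - real (p choose j))" for j
    proof (cases j)
      case (Suc i)
      have "real (n choose j) * real j = real n * real (p choose i)"
        using Suc_times_binomial_eq[of p i] Suc \<open>n = Suc p\<close>
        by (metis of_nat_mult)
      then show ?thesis
        using Suc \<open>n = Suc p\<close> by simp
    qed simp
    have sign: "(-1) ^ (n - j) * real (p choose j) * real j ^ m
        = - ((-1) ^ (p - j) * real (p choose j) * real j ^ m)" if "j \<le> p" for j
      using that Suc by (simp add: Suc_diff_le)
    have "(\<Sum>j\<le>n. (-1) ^ (n - j) * real (n choose j) * real j ^ Suc m)
        = (\<Sum>j\<le>n. real n * ((-1) ^ (n - j) * real (n choose j) * real j ^ m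
            - (-1) ^ (n - j) * real (p choose j) * real j ^ m))"
    proof (rule sum.cong[OF refl])
      fix j
      have "(-1) ^ (n - j) * real (n choose j) * real j ^ Suc m
          = (-1) ^ (n - j) * real j ^ m * (real (n choose j) * real j)"
        by simp
      then show "(-1) ^ (n - j) * real (n choose j) * real j ^ Suc m
          = real n * ((-1) ^ (n - j) * real (n choose j) * real j ^ m
            - (-1) ^ (n - j) * real (p choose j) * real j ^ m)"
        unfolding absorb by (simp add: algebra_simps)
    qed
    also have "\<dots> = real n * (?F n - (\<Sum>j\<le>n. (-1) ^ (n - j) * real (p choose j) * real j ^ m))"
      by (simp add: sum_distrib_left[symmetric] sum_subtractf)
    \<comment> \<open>The term \<open>j = n\<close> vanishes because \<open>p choose n = 0\<close>;
      for smaller \<open>j\<close> the exponents \<open>n - j\<close> and \<open>p - j\<close>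
      differ by one, which flips the sign.\<close>
    also have "(\<Sum>j\<le>n. (-1) ^ (n - j) * real (p choose j) * real j ^ m) = - ?F p"
      using sign by (simp add: Suc sum_negf[symmetric])
    also have "real n * (?F n - - ?F p)
        = real n * (fact n * real (Stirling m n) + fact p * real (Stirling m p))"
      by (simp only: Suc.IH diff_minus_eq_add)
    also have "\<dots> = fact n * real (Stirling (Suc m) n)"
      by (simp add: Suc algebra_simps)
    finally show ?thesis .
  qed
qed

section \<open>Counting surjections between finite sets\<close>

definition surjections :: "'a set \<Rightarrow> 'b set \<Rightarrow> ('a \<Rightarrow> 'b) set" where
  "surjections A B = {f \<in> A \<rightarrow>\<^sub>E B. f ` A = B}"

lemma finite_surjections: "finite A \<Longrightarrow> finite B \<Longrightarrow> finite (surjections A B)"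
  unfolding surjections_def by (simp add: finite_PiE)

text \<open>Deleting \<open>a\<close> from a surjection leaves a map on \<open>A\<close> whose image
  is all of \<open>B\<close>, or \<open>B\<close> without the value at \<open>a\<close> if that
  value is taken nowhere else. These two cases become the two terms of the Stirling
  recurrence.\<close>

lemma surjections_insert:
  assumes "a \<notin> A"
  shows "surjections (insert a A) B
    = (\<lambda>(y, g). g(a := y)) ` (SIGMA y:B. surjections A B \<union> surjections A (B - {y}))"
    (is "?L = ?R")
proof
  show "?L \<subseteq> ?R"
  proof
    fix f assume f: "f \<in> ?L"
    \<comment> \<open>Resetting the value at \<open>a\<close> to \<open>undefined\<close> makes
      \<open>g\<close> extensional on \<open>A\<close>.\<close>
    define g where "g = f(a := undefined)"
    have "g ` A = f ` A"
      using assms by (auto simp: g_def)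
    moreover have "f a \<in> B" "insert (f a) (f ` A) = B"
      using f by (auto simp: surjections_def)
    moreover have "g \<in> extensional A"
      using f by (auto simp: surjections_def g_def PiE_def extensional_def)
    ultimately have "g ` A = B \<or> g ` A = B - {f a}" "g \<in> extensional A"
      by blast+
    then have "g \<in> surjections A B \<union> surjections A (B - {f a})"
      by (auto simp: surjections_def PiE_def)
    moreover have "f = g(a := f a)"
      by (simp add: g_def)
    ultimately show "f \<in> ?R"
      using \<open>f a \<in> B\<close> by (intro image_eqI[of _ _ "(f a, g)"]) auto
  qed
  show "?R \<subseteq> ?L"
  proof clarify
    fix y g assume y: "y \<in> B" and g: "g \<in> surjections A B \<union> surjections A (B - {y})"
    have "(g(a := y)) ` A = g ` A"
      using assms by auto
    moreover have "g \<in> extensional A"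
      using g by (auto simp: surjections_def PiE_def)
    then have "g(a := y) \<in> extensional (insert a A)"
      by (simp add: extensional_def)
    ultimately show "g(a := y) \<in> ?L"
      using y g by (auto simp: surjections_def PiE_def)
  qed
qed

text \<open>Induction on \<open>A\<close>: each value \<open>y\<close> at the new point contributes
  the surjections of \<open>A\<close> onto \<open>B\<close> and those onto \<open>B - {y}\<close>,
  so the counts obey the Stirling recurrence scaled by \<open>fact (card B)\<close>.\<close>

lemma card_surjections:
  assumes "finite A" "finite B"
  shows "card (surjections A B) = fact (card B) * Stirling (card A) (card B)"
  using assms
proof (induction A arbitrary: B rule: finite_induct)
  case empty
  then show ?case
    by (cases "card B") (auto simp: surjections_def)
next
  case (insert a A)
  let ?P = "SIGMA y:B. surjections A B \<union> surjections A (B - {y})"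
  have "inj_on (\<lambda>(y, g). g(a := y)) (B \<times> (A \<rightarrow>\<^sub>E B))"
    using inj_combinator[OF insert.hyps(2), of "\<lambda>_. B"] .
  \<comment> \<open>Maps onto \<open>B - {y}\<close> are also maps into \<open>B\<close>, so
    \<open>?P\<close> lies in the larger product.\<close>
  then have "inj_on (\<lambda>(y, g). g(a := y)) ?P"
    by (rule inj_on_subset) (auto simp: surjections_def PiE_def)
  then have "card (surjections (insert a A) B) = card ?P"
    by (simp add: surjections_insert[OF insert.hyps(2)] card_image)
  also have "\<dots> = (\<Sum>y\<in>B. card (surjections A B \<union> surjections A (B - {y})))"
    using insert by (simp add: finite_surjections)
  also have "\<dots> = (\<Sum>y\<in>B. fact (card B) * Stirling (card A) (card B)
      + fact (card B - 1) * Stirling (card A) (card B - 1))"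
  proof (rule sum.cong[OF refl])
    fix y assume "y \<in> B"
    then have "surjections A B \<inter> surjections A (B - {y}) = {}"
      by (auto simp: surjections_def)
    then have "card (surjections A B \<union> surjections A (B - {y}))
        = card (surjections A B) + card (surjections A (B - {y}))"
      using insert by (intro card_Un_disjoint) (auto simp: finite_surjections)
    then show "card (surjections A B \<union> surjections A (B - {y}))
        = fact (card B) * Stirling (card A) (card B)
          + fact (card B - 1) * Stirling (card A) (card B - 1)"
      using insert \<open>y \<in> B\<close> by simp
  qed
  \<comment> \<open>The truncated \<open>card B - 1\<close> is harmless: for empty \<open>B\<close>
    the sum is empty and \<open>Stirling (Suc k) 0 = 0\<close>.\<close>
  also have "\<dots> = fact (card B) * Stirling (card (insert a A)) (card B)"
    using insert.hyps by (cases "card B") (simp_all add: algebra_simps)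
  finally show ?case .
qed

section \<open>Components as orbits under left translations\<close>

definition component_of :: "'a set \<Rightarrow> ('a \<Rightarrow> 'a \<Rightarrow> 'a) \<Rightarrow> 'a \<Rightarrow> 'a set" where
  "component_of Q op x = orbit (left_mult_group Q op) (\<lambda>g. g) x"

lemma components_eq_image: "components Q op = component_of Q op ` Q"
  by (auto simp: components_def orbits_def component_of_def)

context quandle
begin

text \<open>Existence in left division gives surjectivity, uniqueness gives injectivity.\<close>

lemma left_mult_Bij:
  assumes "a \<in> Q"
  shows "(\<lambda>x\<in>Q. a \<triangleright> x) \<in> Bij Q"
proof -
  have "bij_betw (\<lambda>x. a \<triangleright> x) Q Q"
    unfolding bij_betw_def inj_on_def
    using closed left_div[OF assms] assms by (auto simp: image_iff) metis+
  then show ?thesis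
    by (simp add: Bij_def)
qed

text \<open>The generated group inherits the multiplication of \<open>BijGroup Q\<close>, so its
  inclusion is a homomorphism; general facts about orbits then apply to components.\<close>

lemma group_action_left_mult_group: "group_action (left_mult_group Q (\<triangleright>)) Q (\<lambda>g. g)"
proof -
  interpret B: group "BijGroup Q"
    by (rule group_BijGroup)
  have "(\<lambda>g. g) \<in> hom (left_mult_group Q (\<triangleright>)) (BijGroup Q)"
    using B.carrier_subgroup_generated_subset
    by (auto simp: hom_def left_mult_group_def)
  then show ?thesis
    unfolding group_action_def
    by (simp add: group_hom_def group_hom_axioms_def group_BijGroup left_mult_group_def)
qed

lemma component_of_eq:
  assumes "x \<in> Q" "y \<in> Q" "y \<in> component_of Q (\<triangleright>) x"
  shows "component_of Q (\<triangleright>) y = component_of Q (\<triangleright>) x"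
proof -
  interpret act: group_action "left_mult_group Q (\<triangleright>)" Q "\<lambda>g. g"
    by (rule group_action_left_mult_group)
  show ?thesis
    using act.disjoint_union[of "component_of Q (\<triangleright>) x" "component_of Q (\<triangleright>) y"]
      act.orbit_refl[OF assms(2)] assms
    by (auto simp: orbits_def component_of_def)
qed

text \<open>Left translation by \<open>a\<close> is itself a generator, so it moves \<open>x\<close>
  within its orbit.\<close>

lemma component_of_left_mult:
  assumes "a \<in> Q" "x \<in> Q"
  shows "component_of Q (\<triangleright>) (a \<triangleright> x) = component_of Q (\<triangleright>) x"
proof (rule component_of_eq)
  have "(\<lambda>x\<in>Q. a \<triangleright> x) \<in> carrier (left_mult_group Q (\<triangleright>))"
    unfolding left_mult_group_def carrier_subgroup_generated
    using left_mult_Bij[OF assms(1)] assms(1)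
    by (intro generate.incl) (auto simp: BijGroup_def)
  then show "a \<triangleright> x \<in> component_of Q (\<triangleright>) x"
    using assms(2) unfolding component_of_def orbit_def
    by (intro CollectI exI[of _ "\<lambda>x\<in>Q. a \<triangleright> x"]) simp
qed (use assms closed in auto)

text \<open>The bijections of \<open>Q\<close> that preserve \<open>h\<close> form a subgroup. It
  contains the left translations, hence the group they generate, so \<open>h\<close> is constant on
  orbits.\<close>

lemma invariant_on_component:
  assumes inv: "\<And>a x. a \<in> Q \<Longrightarrow> x \<in> Q \<Longrightarrow> h (a \<triangleright> x) = h x"
    and "x \<in> Q" "y \<in> Q" "component_of Q (\<triangleright>) x = component_of Q (\<triangleright>) y"
  shows "h x = h y"
proof -
  interpret B: group "BijGroup Q"
    by (rule group_BijGroup)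
  let ?H = "{g \<in> Bij Q. \<forall>x\<in>Q. h (g x) = h x}"
  have "subgroup ?H (BijGroup Q)"
  proof (rule B.subgroupI)
    show "?H \<noteq> {}"
      using id_Bij[of Q] by force
  next
    fix g assume g: "g \<in> ?H"
    \<comment> \<open>Invariance under \<open>g\<close> is applied to the preimage of
      \<open>x\<close>.\<close>
    then have "h (inv_into Q g x) = h x" if "x \<in> Q" for x
      using that Bij_inv_into_mem[of g Q x] f_inv_into_f[of x g Q]
      by (auto simp: Bij_def bij_betw_def)
    then show "inv\<^bsub>BijGroup Q\<^esub> g \<in> ?H"
      using g by (auto simp: inv_BijGroup restrict_inv_into_Bij)
  next
    fix f g assume "f \<in> ?H" "g \<in> ?H"
    then show "f \<otimes>\<^bsub>BijGroup Q\<^esub> g \<in> ?H"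
      using Bij_imp_funcset[of g Q] by (auto simp: BijGroup_def compose_Bij compose_eq Pi_iff)
  qed (auto simp: BijGroup_def)
  moreover have "{\<lambda>x\<in>Q. a \<triangleright> x | a. a \<in> Q} \<subseteq> ?H"
    using left_mult_Bij inv by auto
  ultimately have "carrier (left_mult_group Q (\<triangleright>)) \<subseteq> ?H"
    unfolding left_mult_group_def by (rule B.subgroup_generated_minimal)
  moreover have "x \<in> component_of Q (\<triangleright>) y"
    using group_action.orbit_refl[OF group_action_left_mult_group \<open>x \<in> Q\<close>] assms(4)
    by (simp add: component_of_def)
  ultimately show ?thesis
    using \<open>y \<in> Q\<close> by (auto simp: component_of_def orbit_def)
qed

section \<open>Homomorphisms with trivial image\<close>

text \<open>Pulling back along the quotient map is injective because that map is onto the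
  components; every element of \<open>Triv\<close> arises because it is constant on components and
  so descends.\<close>

lemma bij_betw_Triv:
  fixes T :: "'b set" and opT :: "'b \<Rightarrow> 'b \<Rightarrow> 'b"
  shows "bij_betw (\<lambda>f. \<lambda>x\<in>Q. f (component_of Q (\<triangleright>) x))
    {f \<in> components Q (\<triangleright>) \<rightarrow>\<^sub>E T. trivial_quandle (f ` components Q (\<triangleright>)) opT}
    (Triv Q (\<triangleright>) T opT)" (is "bij_betw ?\<Phi> ?F _")
proof (rule bij_betw_imageI)
  let ?c = "component_of Q (\<triangleright>)"
  show "inj_on ?\<Phi> ?F"
  proof (rule inj_onI)
    fix f g assume f: "f \<in> ?F" and g: "g \<in> ?F" and eq: "?\<Phi> f = ?\<Phi> g"
    have "f (?c x) = g (?c x)" if "x \<in> Q" for x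
      using fun_cong[OF eq, of x] that by simp
    then show "f = g"
      using f g by (intro PiE_ext[of f "components Q (\<triangleright>)" "\<lambda>_. T"])
        (auto simp: components_eq_image)
  qed
  show "?\<Phi> ` ?F = Triv Q (\<triangleright>) T opT"
  proof
    show "?\<Phi> ` ?F \<subseteq> Triv Q (\<triangleright>) T opT"
    proof clarify
      fix f assume f: "f \<in> components Q (\<triangleright>) \<rightarrow>\<^sub>E T"
        and triv: "trivial_quandle (f ` components Q (\<triangleright>)) opT"
      have "?\<Phi> f ` Q = f ` components Q (\<triangleright>)"
        by (auto simp: components_eq_image)
      moreover have "?\<Phi> f \<in> Q \<rightarrow>\<^sub>E T"
        using f by (auto simp: components_eq_image)
      \<comment> \<open>Both sides equal \<open>f (?c x)\<close>: the left because translation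
        preserves components, the right because the image is trivial.\<close>
      moreover have "?\<Phi> f (a \<triangleright> x) = opT (?\<Phi> f a) (?\<Phi> f x)" if "a \<in> Q" "x \<in> Q" for a x
        using that trivial_quandle.trivial[OF triv] closed
        by (simp add: component_of_left_mult components_eq_image)
      ultimately show "?\<Phi> f \<in> Triv Q (\<triangleright>) T opT"
        using triv unfolding Triv_def quandle_hom_def by simp
    qed
    show "Triv Q (\<triangleright>) T opT \<subseteq> ?\<Phi> ` ?F"
    proof
      fix h assume h: "h \<in> Triv Q (\<triangleright>) T opT"
      then have hT: "h \<in> Q \<rightarrow>\<^sub>E T" and triv: "trivial_quandle (h ` Q) opT"
        by (auto simp: Triv_def quandle_hom_def)
      have inv: "h (a \<triangleright> x) = h x" if "a \<in> Q" "x \<in> Q" for a x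
        using h that trivial_quandle.trivial[OF triv, of "h a" "h x"]
        by (simp add: Triv_def quandle_hom_def)
      \<comment> \<open>\<open>inv_into\<close> picks a representative of each component;
        \<open>fc\<close> shows that the choice does not affect the value.\<close>
      define f where "f = (\<lambda>C\<in>components Q (\<triangleright>). h (inv_into Q ?c C))"
      have fc: "f (?c x) = h x" if "x \<in> Q" for x
      proof -
        have "?c x \<in> ?c ` Q"
          using that by simp
        then have "h (inv_into Q ?c (?c x)) = h x"
          using invariant_on_component[of h, OF inv] inv_into_into f_inv_into_f that
          by metis
        then show ?thesis
          using that by (simp add: f_def components_eq_image)
      qed
      have "f ` components Q (\<triangleright>) = h ` Q"
        using fc by (auto simp: components_eq_image image_image)
      moreover have "f \<in> components Q (\<triangleright>) \<rightarrow>\<^sub>E T"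
        using hT fc by (auto simp: components_eq_image) (simp add: f_def components_eq_image)
      moreover have "?\<Phi> f = h"
      proof
        fix x
        show "?\<Phi> f x = h x"
          using fc PiE_arb[OF hT] by (cases "x \<in> Q") simp_all
      qed
      ultimately show "h \<in> ?\<Phi> ` ?F"
        using triv by (intro image_eqI[of _ _ f]) auto
    qed
  qed
qed

text \<open>Composing with the quotient map keeps the image, so the bijection onto
  \<open>Triv\<close> restricts to the maps with image \<open>U\<close>.\<close>

lemma bij_betw_hom_onto_trivial_subquandle:
  assumes U: "trivial_subquandle U T opT"
  shows "bij_betw (\<lambda>f. \<lambda>x\<in>Q. f (component_of Q (\<triangleright>) x))
    (surjections (components Q (\<triangleright>)) U) {h \<in> quandle_hom Q (\<triangleright>) T opT. h ` Q = U}"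
proof (rule bij_betw_subset[OF bij_betw_Triv[of T opT]])
  let ?\<Phi> = "\<lambda>f. \<lambda>x\<in>Q. f (component_of Q (\<triangleright>) x)"
  show sub: "surjections (components Q (\<triangleright>)) U
      \<subseteq> {f \<in> components Q (\<triangleright>) \<rightarrow>\<^sub>E T. trivial_quandle (f ` components Q (\<triangleright>)) opT}"
    using U by (auto simp: surjections_def trivial_subquandle_def PiE_iff)
  have im: "?\<Phi> f ` Q = f ` components Q (\<triangleright>)" for f :: "'a set \<Rightarrow> 'b"
    by (auto simp: components_eq_image)
  show "?\<Phi> ` surjections (components Q (\<triangleright>)) U = {h \<in> quandle_hom Q (\<triangleright>) T opT. h ` Q = U}"
  proof
    show "?\<Phi> ` surjections (components Q (\<triangleright>)) U \<subseteq> {h \<in> quandle_hom Q (\<triangleright>) T opT. h ` Q = U}"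
    proof clarify
      fix f assume f: "f \<in> surjections (components Q (\<triangleright>)) U"
      then have "?\<Phi> f \<in> Triv Q (\<triangleright>) T opT"
        using bij_betw_apply[OF bij_betw_Triv[of T opT]] sub by blast
      then show "?\<Phi> f \<in> quandle_hom Q (\<triangleright>) T opT \<and> ?\<Phi> f ` Q = U"
        using f im[of f] by (simp add: Triv_def surjections_def)
    qed
    show "{h \<in> quandle_hom Q (\<triangleright>) T opT. h ` Q = U} \<subseteq> ?\<Phi> ` surjections (components Q (\<triangleright>)) U"
    proof clarify
      fix h assume h: "h \<in> quandle_hom Q (\<triangleright>) T opT" and hU: "U = h ` Q"
      then have "h \<in> Triv Q (\<triangleright>) T opT"
        using U by (simp add: Triv_def trivial_subquandle_def)
      then obtain f where f: "f \<in> components Q (\<triangleright>) \<rightarrow>\<^sub>E T" "h = ?\<Phi> f"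
        using bij_betw_imp_surj_on[OF bij_betw_Triv[of T opT]] by blast
      then have "f \<in> surjections (components Q (\<triangleright>)) (h ` Q)"
        using im[of f] by (auto simp: surjections_def PiE_iff)
      then show "h \<in> ?\<Phi> ` surjections (components Q (\<triangleright>)) (h ` Q)"
        using f by blast
    qed
  qed
qed

end

section \<open>Classification by surjections and the count for a fixed image\<close>

text \<open>For nonempty \<open>S\<close> the sum itself is the exact number of homomorphisms onto
  \<open>U\<close>, so its quotient by \<open>fact n\<close> is claimed only as the size of some
  subset \<open>H\<close>. The exact count fails for empty \<open>S\<close>: the empty map is one
  homomorphism onto the empty \<open>U\<close>, while the sum from 1 to 0 is 0.\<close>

theorem lemma3p11:
  fixes S :: "'a set" and opS :: "'a \<Rightarrow> 'a \<Rightarrow> 'a"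
    and T :: "'b set" and opT :: "'b \<Rightarrow> 'b \<Rightarrow> 'b"
  assumes "quandle S opS" and "medial_quandle T opT"
  shows "Triv S opS T opT \<approx>
           {f. \<exists>U. trivial_subquandle U T opT \<and>
                   f \<in> components S opS \<rightarrow>\<^sub>E U \<and> f ` components S opS = U}
    \<and> (\<forall>U n. trivial_subquandle U T opT \<and> finite U \<and> card U = n \<and>
             finite (components S opS) \<and> n \<le> card (components S opS) \<longrightarrow>
         (\<exists>H \<subseteq> {h \<in> quandle_hom S opS T opT. h ` S = U}. finite H \<and>
            real (card H) = 1 / fact n *
              (\<Sum>j = 1..n. (-1) ^ (n - j) * real (n choose j) * real j ^ card (components S opS))) \<and>
         (S \<noteq> {} \<longrightarrow>
            finite {h \<in> quandle_hom S opS T opT. h ` S = U} \<and>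
            real (card {h \<in> quandle_hom S opS T opT. h ` S = U}) =
              (\<Sum>j = 1..n. (-1) ^ (n - j) * real (n choose j) * real j ^ card (components S opS))))"
proof (intro conjI allI impI)
  interpret S: quandle S opS
    by fact
  \<comment> \<open>\<open>U\<close> is forced to be the image of \<open>f\<close>, so the
    existential disappears.\<close>
  have "{f. \<exists>U. trivial_subquandle U T opT \<and> f \<in> components S opS \<rightarrow>\<^sub>E U \<and> f ` components S opS = U}
      = {f \<in> components S opS \<rightarrow>\<^sub>E T. trivial_quandle (f ` components S opS) opT}"
    by (auto simp: trivial_subquandle_def PiE_iff)
  then show "Triv S opS T opT \<approx>
      {f. \<exists>U. trivial_subquandle U T opT \<and> f \<in> components S opS \<rightarrow>\<^sub>E U \<and> f ` components S opS = U}"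
    using S.bij_betw_Triv[of T opT] by (auto simp: eqpoll_def intro: bij_betw_inv_into)
  fix U n
  let ?k = "card (components S opS)"
  let ?hom = "{h \<in> quandle_hom S opS T opT. h ` S = U}"
  let ?sum = "\<Sum>j = 1..n. (-1) ^ (n - j) * real (n choose j) * real j ^ ?k"
  assume *: "trivial_subquandle U T opT \<and> finite U \<and> card U = n \<and>
    finite (components S opS) \<and> n \<le> ?k"
  obtain \<Phi> where "bij_betw \<Phi> (surjections (components S opS) U) ?hom"
    using S.bij_betw_hom_onto_trivial_subquandle * by blast
  then have fin: "finite ?hom" and card: "card ?hom = fact n * Stirling ?k n"
    using * finite_surjections[of "components S opS" U] card_surjections[of "components S opS" U]
    by (simp_all add: bij_betw_finite flip: bij_betw_same_card)
  have sum: "?sum = fact n * real (Stirling ?k n)" if "S \<noteq> {}"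
  proof -
    \<comment> \<open>With at least one component the term \<open>j = 0\<close> vanishes, so the sum
      may start at 0 or at 1.\<close>
    have "0 < ?k"
      using that * by (simp add: card_gt_0_iff components_eq_image)
    then show ?thesis
      unfolding alternating_sum_eq_fact_Stirling[symmetric]
      by (simp add: atMost_atLeast0 sum.atLeast_Suc_atMost[of 0])
  qed
  show "\<exists>H\<subseteq>?hom. finite H \<and> real (card H) = 1 / fact n * ?sum"
  proof (cases "S = {}")
    case True
    \<comment> \<open>There are no components, so the sum is empty and \<open>H = {}\<close> has the
      required size 0.\<close>
    then have "n = 0"
      using * by (simp add: components_eq_image)
    then show ?thesis
      by (intro exI[of _ "{}"]) simp
  next
    case False
    have "Stirling ?k n \<le> card ?hom"
      by (simp add: card)
    then obtain H where "H \<subseteq> ?hom" "card H = Stirling ?k n" "finite H"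
      by (rule obtain_subset_with_card_n)
    then show ?thesis
      using sum[OF False] by (intro exI[of _ H]) simp
  qed
  show "finite ?hom"
    by (fact fin)
  show "real (card ?hom) = ?sum" if "S \<noteq> {}"
    unfolding card sum[OF that] by simp
qed

end
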